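(* Let $R$ be a semiring, $\mathbf E$ an algebra of type $\tau$, and $V_{\mathbf E}$ the algebra described in the context. Let $I=\{\mathsf e_1,\dots,\mathsf e_n\}\subseteq E$ be finite and nonempty. A vector $\mathbf a=\sum_{\mathsf d\in E}a_{\mathsf d}\mathsf d\in V$ is $I$-central in $V_{\mathbf E}$ if and only if: (i) $a_{\mathsf d}=0$ for all $\mathsf d\in E\setminus I$; (ii) $a_{\mathsf e_1}+\dots+a_{\mathsf e_n}=1$; (iii) $a_{\mathsf e_i}x=xa_{\mathsf e_i}$ for all $x\in R$ and $1\le i\le n$; (iv) $a_{\mathsf e_i}a_{\mathsf e_j}=0$ for $i\ne j$ and $a_{\mathsf e_i}a_{\mathsf e_i}=a_{\mathsf e_i}$, for all $1\le i,j\le n$.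
   Context: A semiring is an algebra $(R,+,\cdot,0,1)$ with $(R,+,0)$ a commutative monoid, $(R,\cdot,1)$ a monoid (not necessarily commutative), $x0=0x=0$, and multiplication distributing over addition on both sides. Let $\mathbf E$ be an algebra of type $\tau$ with universe $E$. Let $V$ be the free left $R$-semimodule with basis $E$: its elements are formal sums $\mathbf v=\sum_{\mathsf d\in E}v_{\mathsf d}\mathsf d$ with $v_{\mathsf d}\in R$ and $v_{\mathsf d}=0$ for all but finitely many $\mathsf d$, with coordinatewise addition, zero vector $\mathbf 0$, and scalar multiplication $r\mathbf v=\sum_{\mathsf d}(rv_{\mathsf d})\mathsf d$; each $\mathsf d\in E$ is identified with the vector having coordinate $1$ at $\mathsf d$ and $0$ elsewhere. Each $k$-ary $g\in\tau$ is lifted linearly: $g^V(\mathbf v^1,\dots,\mathbf v^k)=\sum_{\mathsf d_1,\dots,\mathsf d_k\in E}(v^1_{\mathsf d_1}\cdots v^k_{\mathsf d_k})\,g^{\mathbf E}(\mathsf d_1,\dots,\mathsf d_k)$. For each finite nonempty $I=\{\mathsf e_1,\dots,\mathsf e_n\}\subseteq E$ (listed in a fixed order) define $q_I(\mathbf v,\mathbf w^1,\dots,\mathbf w^n)=\sum_{i=1}^n v_{\mathsf e_i}\mathbf w^i$. $V_{\mathbf E}$ is the algebra with universe $V$ whose operations are: the semimodule operations ($+$, $\mathbf 0$, and the unary maps $\mathbf v\mapsto r\mathbf v$ for each $r\in R$), all $g^V$ ($g\in\tau$), all $q_I$ ($I$ finite nonempty), and every $\mathsf e\in E$ as a constant.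 For $a,b\in V$, $\theta(a,b)$ is the smallest congruence of $V_{\mathbf E}$ containing $(a,b)$. A vector $\mathbf v$ is $I$-central if the map $\mathbf u\mapsto(\mathbf u/\theta(\mathbf v,\mathsf e_1),\dots,\mathbf u/\theta(\mathbf v,\mathsf e_n))$ is an isomorphism from $V_{\mathbf E}$ onto $\prod_{i=1}^n V_{\mathbf E}/\theta(\mathbf v,\mathsf e_i)$ (i.e., $\mathbf v$ is $n$-central in $V_{\mathbf E}$ regarded as an algebra of dimension $n$ with respect to $q_I$ and $\mathsf e_1,\dots,\mathsf e_n$). *)

theory Defs
  imports Main "HOL-Library.FuncSet" "HOL-Library.Poly_Mapping"
begin

section \<open>Universal algebra\<close>

record 'f signature =
  symbols :: "'f set"
  arity :: "'f \<Rightarrow> nat"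

record ('a, 'f) algebra =
  universe :: "'a set"
  interp :: "'f \<Rightarrow> 'a list \<Rightarrow> 'a"

definition args :: "'f signature \<Rightarrow> ('a, 'f) algebra \<Rightarrow> 'f \<Rightarrow> 'a list set"
  where "args \<sigma> A f = {xs. length xs = arity \<sigma> f \<and> set xs \<subseteq> universe A}"

definition is_algebra :: "'f signature \<Rightarrow> ('a, 'f) algebra \<Rightarrow> bool"
  where "is_algebra \<sigma> A \<longleftrightarrow>
    (\<forall>f\<in>symbols \<sigma>. \<forall>xs\<in>args \<sigma> A f. interp A f xs \<in> universe A)"

definition congruence :: "'f signature \<Rightarrow> ('a, 'f) algebra \<Rightarrow> ('a \<times> 'a) set \<Rightarrow> bool"
  where "congruence \<sigma> A \<theta> \<longleftrightarrow> equiv (universe A) \<theta> \<and>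
    (\<forall>f\<in>symbols \<sigma>. \<forall>xs\<in>args \<sigma> A f. \<forall>ys\<in>args \<sigma> A f.
      list_all2 (\<lambda>x y. (x, y) \<in> \<theta>) xs ys \<longrightarrow> (interp A f xs, interp A f ys) \<in> \<theta>)"

definition principal_congruence ::
    "'f signature \<Rightarrow> ('a, 'f) algebra \<Rightarrow> 'a \<Rightarrow> 'a \<Rightarrow> ('a \<times> 'a) set"
  where "principal_congruence \<sigma> A a b = \<Inter>{\<theta>. congruence \<sigma> A \<theta> \<and> (a, b) \<in> \<theta>}"

text \<open>The operations of the quotient are computed on arbitrary representatives; for a
  congruence the resulting set is a single class.\<close>

definition quotient_algebra :: "('a, 'f) algebra \<Rightarrow> ('a \<times> 'a) set \<Rightarrow> ('a set, 'f) algebra"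
  where "quotient_algebra A \<theta> =
    \<lparr> universe = universe A // \<theta>,
      interp = (\<lambda>f Xs. {y. \<exists>xs. list_all2 (\<in>) xs Xs \<and> (interp A f xs, y) \<in> \<theta>}) \<rparr>"

definition product_algebra :: "'i set \<Rightarrow> ('i \<Rightarrow> ('a, 'f) algebra) \<Rightarrow> ('i \<Rightarrow> 'a, 'f) algebra"
  where "product_algebra N A =
    \<lparr> universe = (\<Pi>\<^sub>E i\<in>N. universe (A i)),
      interp = (\<lambda>f xs. \<lambda>i\<in>N. interp (A i) f (map (\<lambda>x. x i) xs)) \<rparr>"

definition isomorphism ::
    "'f signature \<Rightarrow> ('a, 'f) algebra \<Rightarrow> ('b, 'f) algebra \<Rightarrow> ('a \<Rightarrow> 'b) \<Rightarrow> bool"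
  where "isomorphism \<sigma> A B h \<longleftrightarrow> bij_betw h (universe A) (universe B) \<and>
    (\<forall>f\<in>symbols \<sigma>. \<forall>xs\<in>args \<sigma> A f. h (interp A f xs) = interp B f (map h xs))"

text \<open>Centrality of \<open>v\<close> with respect to the designated elements \<open>es = [e\<^sub>1, \<dots>, e\<^sub>n]\<close>.\<close>

definition central :: "'f signature \<Rightarrow> ('a, 'f) algebra \<Rightarrow> 'a list \<Rightarrow> 'a \<Rightarrow> bool"
  where "central \<sigma> A es v \<longleftrightarrow>
    (let \<theta> = (\<lambda>i. principal_congruence \<sigma> A v (es ! i)) in
      isomorphism \<sigma> A
        (product_algebra {..<length es} (\<lambda>i. quotient_algebra A (\<theta> i)))
        (\<lambda>u. \<lambda>i\<in>{..<length es}. \<theta> i `` {u}))"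


section \<open>The algebra of vectors over an algebra\<close>

text \<open>Semirings are types of sort \<open>{semiring_0, monoid_mult}\<close>: unlike \<open>semiring_1\<close>, this
  does not exclude \<open>0 = 1\<close>. A formal sum over \<open>E\<close> is a finitely supported function whose
  support lies in the universe of \<open>E\<close>.\<close>

definition scale :: "'r::{semiring_0, monoid_mult} \<Rightarrow> ('e \<Rightarrow>\<^sub>0 'r) \<Rightarrow> ('e \<Rightarrow>\<^sub>0 'r)"
  where "scale r v = Poly_Mapping.map (\<lambda>x. r * x) v"

lemma lookup_scale: "Poly_Mapping.lookup (scale r v) d = r * Poly_Mapping.lookup v d"
  by (simp add: scale_def Poly_Mapping.map.rep_eq when_def)

abbreviation basis_vector :: "'e \<Rightarrow> ('e \<Rightarrow>\<^sub>0 'r::{semiring_0, monoid_mult})"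
  where "basis_vector d \<equiv> Poly_Mapping.single d 1"

text \<open>The sum over all tuples is restricted to the tuples whose \<open>i\<close>-th entry lies in the
  support of the \<open>i\<close>-th vector; all other terms vanish.\<close>

definition lift_op ::
    "('e list \<Rightarrow> 'e) \<Rightarrow> ('e \<Rightarrow>\<^sub>0 'r::{semiring_0, monoid_mult}) list \<Rightarrow> ('e \<Rightarrow>\<^sub>0 'r)"
  where "lift_op g vs =
    (\<Sum>ds\<in>listset (map Poly_Mapping.keys vs).
      scale (prod_list (map2 Poly_Mapping.lookup vs ds)) (basis_vector (g ds)))"

definition q_op :: "'e list \<Rightarrow> ('e \<Rightarrow>\<^sub>0 'r::{semiring_0, monoid_mult}) \<Rightarrow>
    ('e \<Rightarrow>\<^sub>0 'r) list \<Rightarrow> ('e \<Rightarrow>\<^sub>0 'r)"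
  where "q_op es v ws = (\<Sum>i<length es. scale (Poly_Mapping.lookup v (es ! i)) (ws ! i))"

datatype ('r, 'e, 'f) vsymbol =
  Plus | Zero | Scale 'r | Lift 'f | Q "'e set" | Const 'e

definition vec_signature ::
    "'f signature \<Rightarrow> ('e, 'f) algebra \<Rightarrow> ('r, 'e, 'f) vsymbol signature"
  where "vec_signature \<tau> E =
    \<lparr> symbols = {Plus, Zero} \<union> range Scale \<union> Lift ` symbols \<tau> \<union>
        Q ` {I. finite I \<and> I \<noteq> {} \<and> I \<subseteq> universe E} \<union> Const ` universe E,
      arity = (\<lambda>s. case s of
          Plus \<Rightarrow> 2
        | Zero \<Rightarrow> 0
        | Scale r \<Rightarrow> 1
        | Lift g \<Rightarrow> arity \<tau> g
        | Q I \<Rightarrow> 1 + card I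
        | Const e \<Rightarrow> 0) \<rparr>"

text \<open>The parameter \<open>lst\<close> fixes an order in which each finite nonempty subset of the universe
  of \<open>E\<close> is listed.\<close>

definition is_listing :: "('e, 'f) algebra \<Rightarrow> ('e set \<Rightarrow> 'e list) \<Rightarrow> bool"
  where "is_listing E lst \<longleftrightarrow>
    (\<forall>I. finite I \<and> I \<noteq> {} \<and> I \<subseteq> universe E \<longrightarrow> distinct (lst I) \<and> set (lst I) = I)"

definition vec_algebra :: "('e, 'f) algebra \<Rightarrow> ('e set \<Rightarrow> 'e list) \<Rightarrow>
    ('e \<Rightarrow>\<^sub>0 'r::{semiring_0, monoid_mult}, ('r, 'e, 'f) vsymbol) algebra"
  where "vec_algebra E lst =
    \<lparr> universe = {v. Poly_Mapping.keys v \<subseteq> universe E},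
      interp = (\<lambda>s vs. case s of
          Plus \<Rightarrow> vs ! 0 + vs ! 1
        | Zero \<Rightarrow> 0
        | Scale r \<Rightarrow> scale r (vs ! 0)
        | Lift g \<Rightarrow> lift_op (interp E g) vs
        | Q I \<Rightarrow> q_op (lst I) (hd vs) (tl vs)
        | Const e \<Rightarrow> basis_vector e) \<rparr>"

definition I_central :: "'f signature \<Rightarrow> ('e, 'f) algebra \<Rightarrow> ('e set \<Rightarrow> 'e list) \<Rightarrow>
    'e set \<Rightarrow> ('e \<Rightarrow>\<^sub>0 'r::{semiring_0, monoid_mult}) \<Rightarrow> bool"
  where "I_central \<tau> E lst I v \<longleftrightarrow>
    central (vec_signature \<tau> E) (vec_algebra E lst) (map basis_vector (lst I)) v"

end

theory Submission
  imports Defs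
begin

text \<open>
  The vector \<open>a\<close> is central iff for all \<open>w\<^sub>1, \<dots>, w\<^sub>n\<close> there is exactly one \<open>u\<close> that is congruent
  to each \<open>w\<^sub>i\<close> modulo \<open>\<theta>(a, e\<^sub>i)\<close>. Since \<open>q\<^sub>I(e\<^sub>i, w\<^sub>1, \<dots>, w\<^sub>n) = w\<^sub>i\<close>, the vector
  \<open>q\<^sub>I(a, w\<^sub>1, \<dots>, w\<^sub>n)\<close>, which is the sum of the \<open>a\<^sub>i w\<^sub>i\<close>, is always such a \<open>u\<close>. If \<open>a\<close> is central,
  uniqueness for suitable \<open>w\<close> gives the four conditions on the coefficients. Conversely, if the
  \<open>a\<^sub>i\<close> are orthogonal central idempotents with sum 1, then \<open>\<theta>(a, e\<^sub>i)\<close> relates \<open>u\<close> and \<open>w\<close>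
  precisely when \<open>a\<^sub>i u = a\<^sub>i w\<close>, and \<open>u\<close> is the sum of its components \<open>a\<^sub>i u\<close>.
\<close>

section \<open>Congruences and central elements\<close>

lemma bij_betw_iff_ex1:
  assumes "h ` A \<subseteq> B"
  shows "bij_betw h A B \<longleftrightarrow> (\<forall>y\<in>B. \<exists>!u. u \<in> A \<and> h u = y)"
proof
  assume h: "bij_betw h A B"
  show "\<forall>y\<in>B. \<exists>!u. u \<in> A \<and> h u = y"
  proof
    fix y assume "y \<in> B"
    then obtain u where "u \<in> A" "h u = y"
      using h by (auto simp: bij_betw_def)
    then show "\<exists>!u. u \<in> A \<and> h u = y"
      using h by (auto simp: bij_betw_def inj_on_def)
  qed
next
  assume ex1: "\<forall>y\<in>B. \<exists>!u. u \<in> A \<and> h u = y"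
  then have "inj_on h A"
    using assms by (intro inj_onI) blast
  moreover have "B \<subseteq> h ` A"
    using ex1 by blast
  ultimately show "bij_betw h A B"
    using assms by (auto simp: bij_betw_def)
qed

lemma interp_in_universe:
  assumes "is_algebra \<sigma> A" "f \<in> symbols \<sigma>" "xs \<in> args \<sigma> A f"
  shows "interp A f xs \<in> universe A"
  using assms by (auto simp: is_algebra_def)

lemma congruenceD:
  assumes "congruence \<sigma> A \<theta>"
  shows "equiv (universe A) \<theta>"
    and "\<lbrakk>f \<in> symbols \<sigma>; xs \<in> args \<sigma> A f; ys \<in> args \<sigma> A f; list_all2 (\<lambda>x y. (x, y) \<in> \<theta>) xs ys\<rbrakk>
      \<Longrightarrow> (interp A f xs, interp A f ys) \<in> \<theta>"
  using assms unfolding congruence_def by blast+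

text \<open>This congruence makes the family intersected in \<open>principal_congruence\<close>
  nonempty, which keeps the intersection inside the carrier.\<close>

lemma congruence_total:
  assumes "is_algebra \<sigma> A"
  shows "congruence \<sigma> A (universe A \<times> universe A)"
  unfolding congruence_def
  by (auto simp: equiv_def refl_on_def sym_def trans_def intro: interp_in_universe[OF assms])

lemma principal_congruence_contains: "(a, b) \<in> principal_congruence \<sigma> A a b"
  by (simp add: principal_congruence_def)

lemma principal_congruence_least:
  "congruence \<sigma> A \<theta> \<Longrightarrow> (a, b) \<in> \<theta> \<Longrightarrow> principal_congruence \<sigma> A a b \<subseteq> \<theta>"
  by (auto simp: principal_congruence_def)

text \<open>Symmetry, transitivity and compatibility are inherited by intersections: each is checked
  inside an arbitrary congruence containing the pair. Containment in the carrier comes from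
  \<open>congruence_total\<close>.\<close>

lemma congruence_principal_congruence:
  assumes "is_algebra \<sigma> A" "a \<in> universe A" "b \<in> universe A"
  shows "congruence \<sigma> A (principal_congruence \<sigma> A a b)"
proof -
  let ?P = "principal_congruence \<sigma> A a b"
  have sub: "?P \<subseteq> universe A \<times> universe A"
    using assms by (intro principal_congruence_least congruence_total) simp_all
  have mem: "p \<in> ?P \<longleftrightarrow> (\<forall>\<theta>. congruence \<sigma> A \<theta> \<and> (a, b) \<in> \<theta> \<longrightarrow> p \<in> \<theta>)" for p
    by (auto simp: principal_congruence_def)
  have "refl_on (universe A) ?P"
    by (auto simp: refl_on_def mem congruence_def equiv_def)
  moreover have "sym ?P"
  proof (rule symI)
    fix x y assume "(x, y) \<in> ?P"
    then show "(y, x) \<in> ?P"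
      by (auto simp: mem congruence_def equiv_def dest: symD)
  qed
  moreover have "trans ?P"
  proof (rule transI)
    fix x y z assume xyz: "(x, y) \<in> ?P" "(y, z) \<in> ?P"
    have "(x, z) \<in> \<theta>" if \<theta>: "congruence \<sigma> A \<theta>" "(a, b) \<in> \<theta>" for \<theta>
    proof -
      have "(x, y) \<in> \<theta>" "(y, z) \<in> \<theta>" "trans \<theta>"
        using xyz \<theta> mem congruenceD(1)[OF \<theta>(1)] by (auto simp: equiv_def)
      then show ?thesis
        by (meson transD)
    qed
    then show "(x, z) \<in> ?P"
      by (simp add: mem)
  qed
  moreover have "(interp A f xs, interp A f ys) \<in> ?P"
    if "f \<in> symbols \<sigma>" "xs \<in> args \<sigma> A f" "ys \<in> args \<sigma> A f"
      and rel: "list_all2 (\<lambda>x y. (x, y) \<in> ?P) xs ys" for f xs ys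
    unfolding mem
  proof (intro allI impI, elim conjE)
    fix \<theta> assume \<theta>: "congruence \<sigma> A \<theta>" "(a, b) \<in> \<theta>"
    have "list_all2 (\<lambda>x y. (x, y) \<in> \<theta>) xs ys"
      using rel by (rule list_all2_mono) (use \<theta> mem in blast)
    then show "(interp A f xs, interp A f ys) \<in> \<theta>"
      using congruenceD(2)[OF \<theta>(1)] that by blast
  qed
  ultimately show ?thesis
    using sub by (auto simp: congruence_def equiv_def)
qed

text \<open>Any list of representatives \<open>ys\<close> is related entrywise to \<open>xs\<close>,
  so compatibility puts both results into one class. Since \<open>xs\<close> is itself such a list,
  the union over all choices is exactly that class.\<close>

lemma interp_quotient_algebra:
  assumes alg: "is_algebra \<sigma> A" and \<theta>: "congruence \<sigma> A \<theta>"
    and f: "f \<in> symbols \<sigma>" and xs: "xs \<in> args \<sigma> A f"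
  shows "interp (quotient_algebra A \<theta>) f (map (\<lambda>x. \<theta> `` {x}) xs) = \<theta> `` {interp A f xs}"
proof -
  note eq = congruenceD(1)[OF \<theta>]
  have "(interp A f ys, y) \<in> \<theta> \<longleftrightarrow> (interp A f xs, y) \<in> \<theta>"
    if "list_all2 (\<in>) ys (map (\<lambda>x. \<theta> `` {x}) xs)" for ys y
  proof -
    have rel: "list_all2 (\<lambda>x y. (x, y) \<in> \<theta>) xs ys"
      using that by (auto simp: list_all2_conv_all_nth)
    have "ys \<in> args \<sigma> A f"
      using rel xs eq
      by (auto simp: args_def list_all2_conv_all_nth in_set_conv_nth equiv_def) blast
    then have "(interp A f xs, interp A f ys) \<in> \<theta>"
      using congruenceD(2)[OF \<theta> f xs] rel by blast
    then show ?thesis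
      using eq by (meson equivE symE transE)
  qed
  moreover have "list_all2 (\<in>) xs (map (\<lambda>x. \<theta> `` {x}) xs)"
    using xs eq
    by (auto simp: list_all2_conv_all_nth args_def equiv_def refl_on_def intro!: nth_mem[THEN subsetD[rotated]])
  ultimately show ?thesis
    by (auto simp: quotient_algebra_def)
qed

text \<open>The natural map into the product of quotients is a homomorphism for every
  \<open>v\<close>, so centrality amounts to its bijectivity. Describing each class by a
  representative turns this into unique solvability of simultaneous congruences, as in the Chinese
  remainder theorem.\<close>

lemma central_iff_ex1:
  assumes alg: "is_algebra \<sigma> A" and v: "v \<in> universe A" and es: "set es \<subseteq> universe A"
  shows "central \<sigma> A es v \<longleftrightarrow>
    (\<forall>w. (\<forall>i<length es. w i \<in> universe A) \<longrightarrow>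
      (\<exists>!u. u \<in> universe A \<and>
        (\<forall>i<length es. (u, w i) \<in> principal_congruence \<sigma> A v (es ! i))))"
proof -
  define n where "n = length es"
  define \<theta> where "\<theta> i = principal_congruence \<sigma> A v (es ! i)" for i
  define h where "h u = (\<lambda>i\<in>{..<n}. \<theta> i `` {u})" for u
  have cong: "congruence \<sigma> A (\<theta> i)" if "i < n" for i
    unfolding \<theta>_def using alg v es that nth_mem[of i es]
    by (intro congruence_principal_congruence) (auto simp: n_def)
  note eq = congruenceD(1)[OF cong]
  have hom: "h (interp A f xs) =
      interp (product_algebra {..<n} (\<lambda>i. quotient_algebra A (\<theta> i))) f (map h xs)"
    if fxs: "f \<in> symbols \<sigma>" "xs \<in> args \<sigma> A f" for f xs
  proof -
    have "interp (quotient_algebra A (\<theta> i)) f (map (\<lambda>x. x i) (map h xs)) =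
        \<theta> i `` {interp A f xs}" if i: "i < n" for i
    proof -
      have "map (\<lambda>x. x i) (map h xs) = map (\<lambda>x. \<theta> i `` {x}) xs"
        using i by (simp add: h_def)
      then show ?thesis
        using interp_quotient_algebra[OF alg cong[OF i] fxs] by (simp only:)
    qed
    then show ?thesis
      by (subst h_def) (auto simp: product_algebra_def intro!: restrict_ext)
  qed
  have "central \<sigma> A es v \<longleftrightarrow> bij_betw h (universe A) (\<Pi>\<^sub>E i\<in>{..<n}. universe A // \<theta> i)"
  proof -
    let ?B = "product_algebra {..<n} (\<lambda>i. quotient_algebra A (\<theta> i))"
    have "universe ?B = (\<Pi>\<^sub>E i\<in>{..<n}. universe A // \<theta> i)"
      by (simp add: product_algebra_def quotient_algebra_def)
    moreover have "central \<sigma> A es v \<longleftrightarrow> isomorphism \<sigma> A ?B h"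
      by (simp only: central_def Let_def \<theta>_def[abs_def] n_def h_def[abs_def])
    ultimately show ?thesis
      using hom unfolding isomorphism_def by metis
  qed
  also have "\<dots> \<longleftrightarrow> (\<forall>w. (\<forall>i<n. w i \<in> universe A) \<longrightarrow>
      (\<exists>!u. u \<in> universe A \<and> (\<forall>i<n. (u, w i) \<in> \<theta> i)))" (is "_ \<longleftrightarrow> ?R")
  proof -
    have h_eq: "h u = (\<lambda>i\<in>{..<n}. \<theta> i `` {w i}) \<longleftrightarrow> (\<forall>i<n. (u, w i) \<in> \<theta> i)"
      if "u \<in> universe A" "\<forall>i<n. w i \<in> universe A" for u w
    proof -
      have "h u = (\<lambda>i\<in>{..<n}. \<theta> i `` {w i}) \<longleftrightarrow> (\<forall>i<n. \<theta> i `` {u} = \<theta> i `` {w i})"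
        unfolding h_def by (metis (no_types, lifting) lessThan_iff restrict_apply' restrict_ext)
      also have "\<dots> \<longleftrightarrow> (\<forall>i<n. (u, w i) \<in> \<theta> i)"
        using that eq_equiv_class_iff[OF eq] by blast
      finally show ?thesis .
    qed
    \<comment> \<open>Choosing a representative in each coordinate replaces quantification over
      tuples of classes by quantification over families \<open>w\<close> in the carrier.\<close>
    have "y \<in> (\<Pi>\<^sub>E i\<in>{..<n}. universe A // \<theta> i) \<longleftrightarrow>
        (\<exists>w. (\<forall>i<n. w i \<in> universe A) \<and> y = (\<lambda>i\<in>{..<n}. \<theta> i `` {w i}))" (is "?l \<longleftrightarrow> ?r") for y
    proof
      assume y: ?l
      then have "\<forall>i\<in>{..<n}. \<exists>x. x \<in> universe A \<and> y i = \<theta> i `` {x}"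
        by (fastforce simp: PiE_iff quotient_def)
      then obtain w where "\<forall>i\<in>{..<n}. w i \<in> universe A \<and> y i = \<theta> i `` {w i}"
        by metis
      with y show ?r
        by (intro exI[of _ w]) (auto simp: PiE_iff fun_eq_iff extensional_def)
    qed (auto simp: quotientI)
    then have PiE_image: "(\<Pi>\<^sub>E i\<in>{..<n}. universe A // \<theta> i) =
        (\<lambda>w. \<lambda>i\<in>{..<n}. \<theta> i `` {w i}) ` {w. \<forall>i<n. w i \<in> universe A}"
      by (intro set_eqI) (simp only: image_iff bex_simps mem_Collect_eq Bex_def)
    have h_in: "h u \<in> (\<Pi>\<^sub>E i\<in>{..<n}. universe A // \<theta> i)" if "u \<in> universe A" for u
      using that by (auto simp: h_def quotientI)
    have "bij_betw h (universe A) (\<Pi>\<^sub>E i\<in>{..<n}. universe A // \<theta> i) \<longleftrightarrow>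
        (\<forall>y\<in>(\<Pi>\<^sub>E i\<in>{..<n}. universe A // \<theta> i). \<exists>!u. u \<in> universe A \<and> h u = y)"
      using h_in by (intro bij_betw_iff_ex1 image_subsetI)
    also have "\<dots> \<longleftrightarrow> (\<forall>w. (\<forall>i<n. w i \<in> universe A) \<longrightarrow>
        (\<exists>!u. u \<in> universe A \<and> h u = (\<lambda>i\<in>{..<n}. \<theta> i `` {w i})))"
      unfolding PiE_image by (simp only: ball_simps mem_Collect_eq)
    also have "\<dots> \<longleftrightarrow> ?R"
      by (intro all_cong arg_cong[where f = Ex1] ext conj_cong HOL.refl) (rule h_eq)
    finally show ?thesis .
  qed
  finally show ?thesis
    by (simp add: \<theta>_def n_def)
qed

section \<open>Lifted operations\<close>

lemma scale_zero [simp]: "scale 0 v = 0" "scale r 0 = 0"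
  by (auto intro!: poly_mapping_eqI simp: lookup_scale)

lemma scale_one [simp]: "scale 1 v = v"
  by (auto intro!: poly_mapping_eqI simp: lookup_scale)

lemma scale_scale: "scale r (scale s v) = scale (r * s) v"
  by (auto intro!: poly_mapping_eqI simp: lookup_scale mult.assoc)

lemma scale_add: "scale r (v + w) = scale r v + scale r w"
  by (auto intro!: poly_mapping_eqI simp: lookup_scale lookup_add distrib_left)

lemma scale_sum: "scale r (sum f A) = (\<Sum>x\<in>A. scale r (f x))"
  by (induction A rule: infinite_finite_induct) (auto simp: scale_add)

lemma sum_scale: "scale (sum f A) v = (\<Sum>x\<in>A. scale (f x) v)"
  by (auto intro!: poly_mapping_eqI simp: lookup_scale lookup_sum sum_distrib_right)

lemma keys_scale: "Poly_Mapping.keys (scale r v) \<subseteq> Poly_Mapping.keys v"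
  by (auto simp: in_keys_iff lookup_scale)

section \<open>Products and sums over tuples of basis elements\<close>

lemma mem_listset_iff: "xs \<in> listset As \<longleftrightarrow> list_all2 (\<in>) xs As"
  by (induction As arbitrary: xs) (auto simp: set_Cons_def list_all2_Cons2)

lemma finite_listset: "\<forall>A\<in>set As. finite A \<Longrightarrow> finite (listset As)"
proof (induction As)
  case (Cons A As)
  have "set_Cons A (listset As) = (\<lambda>(x, xs). x # xs) ` (A \<times> listset As)"
    by (auto simp: set_Cons_def)
  then show ?case
    using Cons by simp
qed simp

text \<open>Some entry of \<open>ds\<close> lies off the support of its vector and contributes a
  factor \<open>0\<close>. The length hypothesis excludes tuples that are merely too short, on which
  \<open>map2\<close> would truncate the product.\<close>

lemma prod_list_lookup_eq_0:
  assumes "length ds = length vs" "ds \<notin> listset (map Poly_Mapping.keys vs)"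
  shows "prod_list (map2 Poly_Mapping.lookup vs ds) = (0 :: 'r::{semiring_0, monoid_mult})"
  using assms
proof (induction vs arbitrary: ds)
  case (Cons v vs)
  then show ?case
    by (cases ds) (auto simp: set_Cons_def in_keys_iff)
qed simp

text \<open>Enlarging the index set adds only tuples with a zero coefficient. This matters because
  scaling can shrink supports: sums for different arguments become comparable over a common index
  set.\<close>

lemma lift_op_superset:
  fixes vs :: "('e \<Rightarrow>\<^sub>0 'r::{semiring_0, monoid_mult}) list"
  assumes "list_all2 (\<lambda>v K. Poly_Mapping.keys v \<subseteq> K) vs Ks" "\<forall>K\<in>set Ks. finite K"
  shows "lift_op g vs = (\<Sum>ds\<in>listset Ks.
      scale (prod_list (map2 Poly_Mapping.lookup vs ds)) (basis_vector (g ds)))"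
  unfolding lift_op_def
proof (rule sum.mono_neutral_left)
  show "finite (listset Ks)"
    using assms(2) by (rule finite_listset)
  show "listset (map Poly_Mapping.keys vs) \<subseteq> listset Ks"
    using assms(1) by (fastforce simp: mem_listset_iff list_all2_conv_all_nth)
  show "\<forall>ds\<in>listset Ks - listset (map Poly_Mapping.keys vs).
      scale (prod_list (map2 Poly_Mapping.lookup vs ds)) (basis_vector (g ds)) = 0"
    using assms(1) prod_list_lookup_eq_0[of _ vs]
    by (auto simp: mem_listset_iff dest!: list_all2_lengthD)
qed

text \<open>The outer \<open>c\<close> absorbs the inner copies one at a time; without it the
  products would in general differ by a factor \<open>c\<close>.\<close>

lemma central_idempotent_prod_list:
  fixes c :: "'r::{semiring_0, monoid_mult}"
  assumes "\<And>x. c * x = x * c" "c * c = c"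
  shows "c * prod_list (map2 Poly_Mapping.lookup (map (scale c) vs) ds) =
    c * prod_list (map2 Poly_Mapping.lookup vs ds)"
proof (induction vs arbitrary: ds)
  case (Cons v vs)
  show ?case
  proof (cases ds)
    case [simp]: (Cons d ds')
    let ?P = "\<lambda>vs. prod_list (map2 Poly_Mapping.lookup vs ds')"
    \<comment> \<open>Idempotence merges the two copies of \<open>c\<close> at the head, and
      centrality moves the remaining one next to the product over the tail, ready for the induction
      hypothesis.\<close>
    have "c * (c * Poly_Mapping.lookup v d * ?P (map (scale c) vs)) =
        Poly_Mapping.lookup v d * (c * ?P (map (scale c) vs))"
      by (simp add: mult.assoc[symmetric] assms(2)) (simp add: assms(1)[of "Poly_Mapping.lookup v d"])
    also have "\<dots> = c * (Poly_Mapping.lookup v d * ?P vs)"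
      by (simp add: Cons.IH mult.assoc[symmetric] assms(1)[of "Poly_Mapping.lookup v d"])
    finally show ?thesis
      by (simp add: lookup_scale)
  qed simp
qed simp

text \<open>Both sides are expanded over the supports of the unscaled vectors, where the
  coefficients agree term by term.\<close>

lemma central_idempotent_lift_op:
  fixes c :: "'r::{semiring_0, monoid_mult}"
  assumes "\<And>x. c * x = x * c" "c * c = c"
  shows "scale c (lift_op g (map (scale c) vs)) = scale c (lift_op g vs)"
proof -
  have "lift_op g (map (scale c) vs) = (\<Sum>ds\<in>listset (map Poly_Mapping.keys vs).
      scale (prod_list (map2 Poly_Mapping.lookup (map (scale c) vs) ds)) (basis_vector (g ds)))"
    by (intro lift_op_superset) (auto simp: list_all2_conv_all_nth keys_scale[THEN subsetD])
  then show ?thesis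
    by (simp add: lift_op_def scale_sum scale_scale central_idempotent_prod_list[OF assms])
qed

section \<open>The vector algebra\<close>

abbreviation vecs :: "('e, 'f) algebra \<Rightarrow> ('e \<Rightarrow>\<^sub>0 'r::{semiring_0, monoid_mult}) set"
  where "vecs E \<equiv> {v. Poly_Mapping.keys v \<subseteq> universe E}"

lemma universe_vec_algebra [simp]: "universe (vec_algebra E lst) = vecs E"
  by (simp add: vec_algebra_def)

lemma vecs_add: "v \<in> vecs E \<Longrightarrow> w \<in> vecs E \<Longrightarrow> v + w \<in> vecs E"
  using Poly_Mapping.keys_add[of v w] by auto

lemma vecs_scale: "v \<in> vecs E \<Longrightarrow> scale r v \<in> vecs E"
  using keys_scale by fastforce

lemma vecs_sum: "(\<And>x. x \<in> A \<Longrightarrow> f x \<in> vecs E) \<Longrightarrow> sum f A \<in> vecs E"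
  using keys_sum[of f A] by fastforce

lemma vecs_basis: "d \<in> universe E \<Longrightarrow> basis_vector d \<in> vecs E"
  by (auto simp: in_keys_iff lookup_single when_def split: if_splits)

lemma listing_length:
  assumes "is_listing E lst" "finite I" "I \<noteq> {}" "I \<subseteq> universe E"
  shows "length (lst I) = card I"
  using assms by (metis is_listing_def distinct_card)

lemma is_algebra_vec_algebra:
  assumes alg: "is_algebra \<tau> E" and lst: "is_listing E lst"
  shows "is_algebra (vec_signature \<tau> E)
    (vec_algebra E lst :: ('e \<Rightarrow>\<^sub>0 'r::{semiring_0, monoid_mult}, ('r, 'e, 'f) vsymbol) algebra)"
  unfolding is_algebra_def
proof (intro ballI)
  fix f and vs :: "('e \<Rightarrow>\<^sub>0 'r) list"
  assume f: "f \<in> symbols (vec_signature \<tau> E)"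
    and "vs \<in> args (vec_signature \<tau> E) (vec_algebra E lst) f"
  then have len: "length vs = arity (vec_signature \<tau> E) f" and vs: "set vs \<subseteq> vecs E"
    by (auto simp: args_def)
  show "interp (vec_algebra E lst) f vs \<in> universe (vec_algebra E lst)"
  proof (cases f)
    case Plus
    then have "vs ! 0 \<in> vecs E" "vs ! 1 \<in> vecs E"
      using len vs by (auto simp: vec_signature_def intro!: subsetD[OF vs] nth_mem
          simp del: mem_Collect_eq)
    then show ?thesis
      using Plus vecs_add by (simp add: vec_algebra_def)
  next
    case Zero
    then show ?thesis
      by (simp add: vec_algebra_def)
  next
    case (Scale r)
    then have "vs ! 0 \<in> vecs E"
      using len vs by (auto simp: vec_signature_def intro!: subsetD[OF vs] nth_mem
          simp del: mem_Collect_eq)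
    then show ?thesis
      using Scale vecs_scale by (simp add: vec_algebra_def)
  next
    case (Lift g)
    have "lift_op (interp E g) vs \<in> vecs E"
      unfolding lift_op_def
    proof (intro vecs_sum vecs_scale vecs_basis)
      fix ds assume ds: "ds \<in> listset (map Poly_Mapping.keys vs)"
      have "ds \<in> args \<tau> E g"
        using ds vs len Lift
        by (fastforce simp: args_def vec_signature_def mem_listset_iff list_all2_conv_all_nth
            in_set_conv_nth)
      then show "interp E g ds \<in> universe E"
        using interp_in_universe[OF alg] f Lift by (auto simp: vec_signature_def)
    qed
    then show ?thesis
      using Lift by (simp add: vec_algebra_def)
  next
    case (Q J)
    then have J: "finite J" "J \<noteq> {}" "J \<subseteq> universe E"
      using f by (auto simp: vec_signature_def)
    have "q_op (lst J) (hd vs) (tl vs) \<in> vecs E"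
      unfolding q_op_def
    proof (intro vecs_sum vecs_scale)
      fix i assume "i \<in> {..<length (lst J)}"
      \<comment> \<open>The arity of \<open>Q J\<close> is \<open>1 + card J\<close>: the head of
        \<open>vs\<close> supplies the coefficients, and only the tail supplies the vectors being
        combined.\<close>
      then have "Suc i < length vs"
        using Q len listing_length[OF lst J] by (simp add: vec_signature_def)
      then show "tl vs ! i \<in> vecs E"
        using vs by (metis nth_tl Suc_less_eq length_tl less_diff_conv nth_mem subsetD add.commute plus_1_eq_Suc)
    qed
    then show ?thesis
      using Q by (simp add: vec_algebra_def)
  next
    case (Const e)
    then show ?thesis
      using f vecs_basis[of e E] by (auto simp: vec_signature_def vec_algebra_def)
  qed
qed

section \<open>Selection by \<open>q_op\<close>, and congruences of the vector algebra\<close>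

lemma sum_scale_basis_vector:
  assumes "distinct es" "i < length es"
  shows "(\<Sum>j<length es. scale (Poly_Mapping.lookup (basis_vector (es ! i)) (es ! j)) (w j)) = w i"
proof -
  have "scale (Poly_Mapping.lookup (basis_vector (es ! i)) (es ! j)) (w j) = (if j = i then w i else 0)"
    if "j < length es" for j
    using assms that by (auto simp: lookup_single when_def nth_eq_iff_index_eq)
  then show ?thesis
    using assms by simp
qed

text \<open>Compatibility with \<open>Q I\<close> allows \<open>a\<close> to be replaced by the
  basis vector in the first argument, after which \<open>q_op\<close> selects \<open>w i\<close>.
  The combined vector does not depend on \<open>i\<close>, so it solves all the congruences for
  \<open>w\<close> at once.\<close>

lemma congruence_q_op:
  fixes a :: "'e \<Rightarrow>\<^sub>0 'r::{semiring_0, monoid_mult}"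
  assumes lst: "is_listing E lst" and I: "finite I" "I \<noteq> {}" "I \<subseteq> universe E"
    and \<theta>: "congruence (vec_signature \<tau> E) (vec_algebra E lst) \<theta>"
    and a: "(a, basis_vector (lst I ! i)) \<in> \<theta>" and i: "i < length (lst I)"
    and w: "\<And>j. j < length (lst I) \<Longrightarrow> w j \<in> vecs E"
  shows "((\<Sum>j<length (lst I). scale (Poly_Mapping.lookup a (lst I ! j)) (w j)), w i) \<in> \<theta>"
proof -
  let ?n = "length (lst I)" and ?ws = "map w [0..<length (lst I)]"
  have eq: "equiv (vecs E) \<theta>"
    using congruenceD(1)[OF \<theta>] by simp
  have q: "interp (vec_algebra E lst) (Q I) (v # ?ws) =
      (\<Sum>j<?n. scale (Poly_Mapping.lookup v (lst I ! j)) (w j))" for v :: "'e \<Rightarrow>\<^sub>0 'r"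
    by (simp add: vec_algebra_def q_op_def)
  have args: "v # ?ws \<in> args (vec_signature \<tau> E) (vec_algebra E lst) (Q I)"
    if "v \<in> vecs E" for v
    using that w listing_length[OF lst I] by (fastforce simp: args_def vec_signature_def)
  have "(interp (vec_algebra E lst) (Q I) (a # ?ws),
      interp (vec_algebra E lst) (Q I) (basis_vector (lst I ! i) # ?ws)) \<in> \<theta>"
  proof (rule congruenceD(2)[OF \<theta>])
    show "Q I \<in> symbols (vec_signature \<tau> E)"
      using I by (simp add: vec_signature_def)
    show "list_all2 (\<lambda>x y. (x, y) \<in> \<theta>) (a # ?ws) (basis_vector (lst I ! i) # ?ws)"
      using a w eq by (auto simp: list_all2_conv_all_nth nth_Cons equiv_def refl_on_def split: nat.split)
  qed (use a eq in \<open>auto intro!: args simp: equiv_def\<close>)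
  moreover have "distinct (lst I)"
    using lst I by (simp add: is_listing_def)
  ultimately show ?thesis
    using sum_scale_basis_vector[OF _ i, of w] by (simp add: q)
qed

text \<open>A central idempotent distributes over every product, so multiplying all arguments of a
  multilinear operation by it changes nothing once the result is multiplied by it as well.\<close>

lemma congruence_central_idempotent:
  fixes c :: "'r::{semiring_0, monoid_mult}" and E :: "('e, 'f) algebra"
  assumes alg: "is_algebra \<tau> E" and lst: "is_listing E lst"
    and c: "\<And>x. c * x = x * c" "c * c = c"
  shows "congruence (vec_signature \<tau> E) (vec_algebra E lst)
    {(u, w). u \<in> vecs E \<and> w \<in> vecs E \<and> scale c u = scale c w}"
    (is "congruence _ _ ?\<theta>")
proof -
  have equiv: "equiv (vecs E) ?\<theta>"
    by (auto simp: equiv_def refl_on_def sym_def trans_def)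
  have scale_eq: "scale c (interp (vec_algebra E lst) f xs) = scale c (interp (vec_algebra E lst) f ys)"
    if f: "f \<in> symbols (vec_signature \<tau> E)"
      and len: "length xs = arity (vec_signature \<tau> E) f"
      and map_eq: "map (scale c) xs = map (scale c) ys" for f xs ys
  proof -
    have leny: "length ys = length xs"
      using map_eq by (metis length_map)
    have nth: "scale c (xs ! i) = scale c (ys ! i)" if "i < length xs" for i
      using map_eq that leny by (metis nth_map)
    show ?thesis
    proof (cases f)
      case Plus
      then show ?thesis
        using nth[of 0] nth[of 1] len by (simp add: vec_algebra_def vec_signature_def scale_add)
    next
      \<comment> \<open>Centrality of \<open>c\<close> lets it pass the scalar \<open>r\<close> and
        reach the vector.\<close>
      case (Scale r)
      then show ?thesis
        using nth[of 0] len c(1)[of r]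
        by (simp add: vec_algebra_def vec_signature_def scale_scale) (metis scale_scale)
    next
      \<comment> \<open>Both values, once scaled by \<open>c\<close>, equal the scaled value on the
        common list \<open>map (scale c) xs\<close>.\<close>
      case (Lift g)
      then show ?thesis
        using central_idempotent_lift_op[OF c, of _ xs] central_idempotent_lift_op[OF c, of _ ys] map_eq
        by (simp add: vec_algebra_def)
    next
      case (Q J)
      then have J: "finite J" "J \<noteq> {}" "J \<subseteq> universe E"
        using f by (auto simp: vec_signature_def)
      have lenJ: "length xs = Suc (length (lst J))"
        using Q len listing_length[OF lst J] by (simp add: vec_signature_def)
      then obtain x xs' y ys' where xy: "xs = x # xs'" "ys = y # ys'"
        using leny by (metis length_Suc_conv)
      have "scale c x = scale c y"
        using nth[of 0] xy by simp
      then have head: "c * Poly_Mapping.lookup x d = c * Poly_Mapping.lookup y d" for d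
        by (metis lookup_scale)
      \<comment> \<open>Since \<open>c\<close> is a central idempotent,
        \<open>c * r = c * r * c\<close>. Hence scaling by \<open>c * r\<close> sees a vector only
        through its multiple by \<open>c\<close>, which handles the tail arguments;
        \<open>head\<close> handles the coefficients.\<close>
      have split: "scale (c * r) v = scale (c * r) (scale c v)" for r and v :: "'e \<Rightarrow>\<^sub>0 'r"
        by (metis c mult.assoc scale_scale)
      have "scale (c * Poly_Mapping.lookup x (lst J ! i)) (xs' ! i) =
          scale (c * Poly_Mapping.lookup y (lst J ! i)) (ys' ! i)" if "i < length (lst J)" for i
        using nth[of "Suc i"] that lenJ xy split head by (metis nth_Cons_Suc Suc_less_eq)
      then show ?thesis
        using Q xy by (simp add: vec_algebra_def q_op_def scale_sum scale_scale)
    qed (simp_all add: vec_algebra_def)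
  qed
  have map_eq: "map (scale c) xs = map (scale c) ys" if "list_all2 (\<lambda>x y. (x, y) \<in> ?\<theta>) xs ys" for xs ys
    using that by (auto simp: list_all2_conv_all_nth intro!: nth_equalityI)
  have closed: "interp (vec_algebra E lst) f xs \<in> vecs E"
    if "f \<in> symbols (vec_signature \<tau> E)" "xs \<in> args (vec_signature \<tau> E) (vec_algebra E lst) f"
    for f and xs :: "('e \<Rightarrow>\<^sub>0 'r) list"
    using interp_in_universe[OF is_algebra_vec_algebra[OF alg lst] that] by simp
  have "(interp (vec_algebra E lst) f xs, interp (vec_algebra E lst) f ys) \<in> ?\<theta>"
    if "f \<in> symbols (vec_signature \<tau> E)"
      and "xs \<in> args (vec_signature \<tau> E) (vec_algebra E lst) f"
      and "ys \<in> args (vec_signature \<tau> E) (vec_algebra E lst) f"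
      and "list_all2 (\<lambda>x y. (x, y) \<in> ?\<theta>) xs ys" for f xs ys
  proof -
    have "length xs = arity (vec_signature \<tau> E) f"
      using that(2) by (simp add: args_def)
    then show ?thesis
      using scale_eq[OF that(1) _ map_eq[OF that(4)]] closed that(1-3) by blast
  qed
  with equiv show ?thesis
    unfolding congruence_def universe_vec_algebra by blast
qed

section \<open>Centrality and the coefficients\<close>

lemma congruence_scale:
  fixes u w :: "'e \<Rightarrow>\<^sub>0 'r::{semiring_0, monoid_mult}"
  assumes \<theta>: "congruence (vec_signature \<tau> E) (vec_algebra E lst) \<theta>" and uw: "(u, w) \<in> \<theta>"
  shows "(scale r u, scale r w) \<in> \<theta>"
proof -
  have "u \<in> vecs E" "w \<in> vecs E"
    using congruenceD(1)[OF \<theta>] uw by (auto simp: equiv_def)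
  then show ?thesis
    using congruenceD(2)[OF \<theta>, of "Scale r" "[u]" "[w]"] uw
    by (simp add: vec_signature_def vec_algebra_def args_def)
qed

lemma I_central_iff_ex1:
  fixes a :: "'e \<Rightarrow>\<^sub>0 'r::{semiring_0, monoid_mult}"
  assumes alg: "is_algebra \<tau> E" and lst: "is_listing E lst"
    and I: "finite I" "I \<noteq> {}" "I \<subseteq> universe E"
    and a: "a \<in> vecs E"
  shows "I_central \<tau> E lst I a \<longleftrightarrow>
    (\<forall>w. (\<forall>i<length (lst I). w i \<in> vecs E) \<longrightarrow>
      (\<exists>!u. u \<in> vecs E \<and> (\<forall>i<length (lst I).
        (u, w i) \<in> principal_congruence (vec_signature \<tau> E) (vec_algebra E lst) a
          (basis_vector (lst I ! i)))))"
proof -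
  have "set (lst I) = I"
    using lst I by (simp add: is_listing_def)
  then have "set (map basis_vector (lst I)) \<subseteq> (vecs E :: ('e \<Rightarrow>\<^sub>0 'r) set)"
    using I(3) vecs_basis by fastforce
  then show ?thesis
    unfolding I_central_def using a
    by (subst central_iff_ex1[OF is_algebra_vec_algebra[OF alg lst]]) simp_all
qed

text \<open>Each condition compares two solutions of one system of congruences. The family of basis
  vectors of \<open>I\<close> gives the support, a constant family gives the sum, and families that
  vanish except at one index give commutation and orthogonality.\<close>

lemma central_imp_coefficients:
  fixes a :: "'e \<Rightarrow>\<^sub>0 'r::{semiring_0, monoid_mult}"
  assumes alg: "is_algebra \<tau> E" and lst: "is_listing E lst"
    and I: "finite I" "I \<noteq> {}" "I \<subseteq> universe E"
    and a: "a \<in> vecs E"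
    and central: "I_central \<tau> E lst I a"
  shows "\<forall>d\<in>universe E - I. Poly_Mapping.lookup a d = 0"
    and "(\<Sum>e\<in>I. Poly_Mapping.lookup a e) = 1"
    and "\<forall>e\<in>I. \<forall>x. Poly_Mapping.lookup a e * x = x * Poly_Mapping.lookup a e"
    and "\<forall>e\<in>I. \<forall>e'\<in>I.
      Poly_Mapping.lookup a e * Poly_Mapping.lookup a e' = (if e = e' then Poly_Mapping.lookup a e else 0)"
proof -
  define es where "es = lst I"
  define n where "n = length es"
  define A where "A i = Poly_Mapping.lookup a (es ! i)" for i
  define \<theta> where "\<theta> i = principal_congruence (vec_signature \<tau> E) (vec_algebra E lst) a
    (basis_vector (es ! i))" for i
  have es: "distinct es" "set es = I"
    using lst I by (auto simp: es_def is_listing_def)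
  have basis: "basis_vector (es ! i) \<in> vecs E" if "i < n" for i
    using that es I by (intro vecs_basis) (auto simp: n_def)
  have cong: "congruence (vec_signature \<tau> E) (vec_algebra E lst) (\<theta> i)" if "i < n" for i
    unfolding \<theta>_def using a basis[OF that]
    by (intro congruence_principal_congruence is_algebra_vec_algebra alg lst) simp_all
  have eq: "equiv (vecs E) (\<theta> i)" if "i < n" for i
    using congruenceD(1)[OF cong[OF that]] by simp
  have refl: "(u, u) \<in> \<theta> i" if "i < n" "u \<in> vecs E" for i u
    using eq that by (auto simp: equiv_def refl_on_def)
  have contains: "(a, basis_vector (es ! i)) \<in> \<theta> i" for i
    by (simp add: \<theta>_def principal_congruence_contains)
  have ex1: "\<exists>!u. u \<in> vecs E \<and> (\<forall>i<n. (u, w i) \<in> \<theta> i)" if "\<And>i. i < n \<Longrightarrow> w i \<in> vecs E" for w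
    using central that unfolding I_central_iff_ex1[OF alg lst I a] n_def es_def \<theta>_def by blast
  have combine: "((\<Sum>j<n. scale (A j) (w j)), w i) \<in> \<theta> i"
    if "i < n" "\<And>j. j < n \<Longrightarrow> w j \<in> vecs E" for i w
    using congruence_q_op[OF lst I cong[OF that(1)], of a i w] contains that
    by (simp add: n_def es_def A_def)
  \<comment> \<open>By \<open>combine\<close> the explicit sum solves the system, and
    \<open>ex1\<close> leaves no other solution.\<close>
  have unique: "u = (\<Sum>j<n. scale (A j) (w j))"
    if "u \<in> vecs E" "\<And>j. j < n \<Longrightarrow> w j \<in> vecs E" "\<And>i. i < n \<Longrightarrow> (u, w i) \<in> \<theta> i" for u w
  proof -
    have "(\<Sum>j<n. scale (A j) (w j)) \<in> vecs E"
      by (rule vecs_sum, rule vecs_scale) (use that(2) in auto)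
    then show ?thesis
      using ex1[of w, OF that(2)] that(1,3) combine[of _ w, OF _ that(2)] by blast
  qed
  have sum_delta: "(\<Sum>j<n. scale (A j) (if j = i then u else 0)) = scale (A i) u" if "i < n" for i u
  proof -
    have "(\<Sum>j<n. scale (A j) (if j = i then u else 0)) = (\<Sum>j<n. if j = i then scale (A i) u else 0)"
      by (intro sum.cong) auto
    then show ?thesis
      using that by simp
  qed
  \<comment> \<open>\<open>scale (A i) u\<close> acts as the \<open>i\<close>-th component of
    \<open>u\<close>: it solves the system with \<open>u\<close> at index \<open>i\<close> and
    \<open>0\<close> elsewhere.\<close>
  have component: "(scale (A i) u, if k = i then u else 0) \<in> \<theta> k" if "i < n" "k < n" "u \<in> vecs E" for i k u
    using combine[of k "\<lambda>j. if j = i then u else 0"] that by (simp add: sum_delta)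
  have component_unique: "x = scale (A i) u"
    if "i < n" "x \<in> vecs E" "u \<in> vecs E" "\<And>k. k < n \<Longrightarrow> (x, if k = i then u else 0) \<in> \<theta> k" for i x u
    using unique[of x "\<lambda>j. if j = i then u else 0"] that by (simp add: sum_delta)
  \<comment> \<open>A test vector, available because \<open>I\<close> is nonempty: its coordinate
    \<open>1\<close> turns equations between multiples of \<open>b\<close> into equations between
    scalars.\<close>
  define b where "b = (basis_vector (es ! 0) :: 'e \<Rightarrow>\<^sub>0 'r)"
  have n: "0 < n"
    using es I by (auto simp: n_def)
  have b: "b \<in> vecs E"
    using basis[OF n] by (simp add: b_def)
  have scale_b: "r = s" if "scale r b = scale s b" for r s
    using arg_cong[OF that, of "\<lambda>v. Poly_Mapping.lookup v (es ! 0)"]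
    by (simp add: b_def lookup_scale)
  have index: "\<exists>i<n. e = es ! i" if "e \<in> I" for e
    using that es by (metis in_set_conv_nth n_def)

  \<comment> \<open>By the choice of the congruences, \<open>a\<close> solves the system given by
    the basis vectors themselves; the resulting sum visibly has no coordinates outside
    \<open>I\<close>.\<close>
  have a_eq: "a = (\<Sum>j<n. scale (A j) (basis_vector (es ! j)))"
    by (rule unique) (use a basis contains in blast)+
  show "\<forall>d\<in>universe E - I. Poly_Mapping.lookup a d = 0"
  proof
    fix d assume "d \<in> universe E - I"
    then have "es ! j \<noteq> d" if "j < n" for j
      using that es by (auto simp: n_def)
    then show "Poly_Mapping.lookup a d = 0"
      by (subst a_eq) (simp add: lookup_sum lookup_scale lookup_single)
  qed

  \<comment> \<open>By reflexivity \<open>b\<close> solves the constant system.\<close>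
  have "b = (\<Sum>j<n. scale (A j) b)"
    by (rule unique) (use b refl in blast)+
  then have "scale 1 b = scale (\<Sum>j<n. A j) b"
    by (simp add: sum_scale)
  then have "(\<Sum>j<n. A j) = 1"
    using scale_b by metis
  moreover have "(\<Sum>j<n. A j) = (\<Sum>e\<in>I. Poly_Mapping.lookup a e)"
    using sum.reindex_bij_betw[OF bij_betw_nth[OF es(1), of "{..<n}" I], of "Poly_Mapping.lookup a"] es(2)
    by (simp add: A_def n_def)
  ultimately show "(\<Sum>e\<in>I. Poly_Mapping.lookup a e) = 1"
    by simp

  show "\<forall>e\<in>I. \<forall>x. Poly_Mapping.lookup a e * x = x * Poly_Mapping.lookup a e"
  proof (intro ballI allI)
    fix e x assume "e \<in> I"
    then obtain i where i: "i < n" "e = es ! i"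
      using index by blast
    \<comment> \<open>Scaling by \<open>x\<close> respects every congruence, so it sends the
      solution for \<open>b\<close> at index \<open>i\<close> to a solution for
      \<open>scale x b\<close> at index \<open>i\<close>.\<close>
    have "scale x (scale (A i) b) = scale (A i) (scale x b)"
    proof (rule component_unique)
      fix k assume k: "k < n"
      have "(scale x (scale (A i) b), scale x (if k = i then b else 0)) \<in> \<theta> k"
        using component i k b by (intro congruence_scale[OF cong]) auto
      then show "(scale x (scale (A i) b), if k = i then scale x b else 0) \<in> \<theta> k"
        by (auto split: if_splits)
    qed (use i b vecs_scale in blast)+
    then show "Poly_Mapping.lookup a e * x = x * Poly_Mapping.lookup a e"
      using scale_b by (simp add: scale_scale A_def i)
  qed

  show "\<forall>e\<in>I. \<forall>e'\<in>I.
      Poly_Mapping.lookup a e * Poly_Mapping.lookup a e' = (if e = e' then Poly_Mapping.lookup a e else 0)"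
  proof (intro ballI)
    fix e e' assume "e \<in> I" "e' \<in> I"
    then obtain i j where i: "i < n" "e = es ! i" and j: "j < n" "e' = es ! j"
      using index by metis
    have e_eq: "e = e' \<longleftrightarrow> i = j"
      using i j es(1) by (simp add: nth_eq_iff_index_eq n_def)
    \<comment> \<open>Consider the system with \<open>scale (A j) b\<close> at index
      \<open>i\<close> and \<open>0\<close> elsewhere. For \<open>i = j\<close>,
      \<open>scale (A i) b\<close> already solves it; otherwise \<open>0\<close> does, because the
      \<open>j\<close>-th component vanishes modulo \<open>\<theta> i\<close>.\<close>
    have "(if i = j then scale (A i) b else 0) = scale (A i) (scale (A j) b)"
    proof (rule component_unique)
      fix k assume k: "k < n"
      show "(if i = j then scale (A i) b else 0, if k = i then scale (A j) b else 0) \<in> \<theta> k"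
        using component[OF i(1) k b] component[OF j(1) k b] refl[OF k, of "scale (A i) b"]
          refl[OF k, of 0] eq[OF k] vecs_scale[OF b]
        by (auto simp: equiv_def dest: symD)
    qed (use i b vecs_scale[OF b] in auto)
    then have "scale (A i * A j) b = scale (if i = j then A i else 0) b"
      by (auto simp: scale_scale split: if_splits)
    then show "Poly_Mapping.lookup a e * Poly_Mapping.lookup a e' = (if e = e' then Poly_Mapping.lookup a e else 0)"
      using scale_b unfolding e_eq by (metis A_def i(2) j(2))
  qed
qed

text \<open>Once each principal congruence is identified as the kernel of scaling by
  \<open>A i\<close>, unique solvability becomes a computation with orthogonal idempotents.\<close>

lemma coefficients_imp_central:
  fixes a :: "'e \<Rightarrow>\<^sub>0 'r::{semiring_0, monoid_mult}"
  assumes alg: "is_algebra \<tau> E" and lst: "is_listing E lst"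
    and I: "finite I" "I \<noteq> {}" "I \<subseteq> universe E"
    and a: "a \<in> vecs E"
    and supp: "\<forall>d\<in>universe E - I. Poly_Mapping.lookup a d = 0"
    and sum_1: "(\<Sum>e\<in>I. Poly_Mapping.lookup a e) = 1"
    and comm: "\<forall>e\<in>I. \<forall>x. Poly_Mapping.lookup a e * x = x * Poly_Mapping.lookup a e"
    and orth: "\<forall>e\<in>I. \<forall>e'\<in>I.
      Poly_Mapping.lookup a e * Poly_Mapping.lookup a e' = (if e = e' then Poly_Mapping.lookup a e else 0)"
  shows "I_central \<tau> E lst I a"
proof -
  define es where "es = lst I"
  define n where "n = length es"
  define A where "A i = Poly_Mapping.lookup a (es ! i)" for i
  have es: "distinct es" "set es = I"
    using lst I by (auto simp: es_def is_listing_def)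
  have nth_I: "es ! i \<in> I" if "i < n" for i
    using that es by (auto simp: n_def)
  have sum_A: "(\<Sum>j<n. A j) = 1"
    using sum.reindex_bij_betw[OF bij_betw_nth[OF es(1), of "{..<n}" I], of "Poly_Mapping.lookup a"] es(2) sum_1
    by (simp add: A_def n_def)
  have A_orth: "A i * A j = (if i = j then A i else 0)" if "i < n" "j < n" for i j
    using orth nth_I that es(1) by (simp add: A_def nth_eq_iff_index_eq n_def)
  have basis: "basis_vector (es ! i) \<in> vecs E" if "i < n" for i
    using nth_I[OF that] I by (intro vecs_basis) auto
  have \<theta>: "principal_congruence (vec_signature \<tau> E) (vec_algebra E lst) a (basis_vector (es ! i)) =
      {(u, w). u \<in> vecs E \<and> w \<in> vecs E \<and> scale (A i) u = scale (A i) w}" (is "?P = ?K")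
    if i: "i < n" for i
  proof
    \<comment> \<open>This places the generating pair in the kernel. On \<open>I\<close>,
      orthogonality leaves only the coordinate at \<open>es ! i\<close>; off \<open>I\<close>, the
      coordinates of \<open>a\<close> vanish by \<open>supp\<close> inside the carrier and by
      \<open>a\<close> outside it.\<close>
    have "Poly_Mapping.lookup (scale (A i) a) d = Poly_Mapping.lookup (scale (A i) (basis_vector (es ! i))) d" for d
    proof (cases "d \<in> I")
      case True
      then show ?thesis
        using orth nth_I[OF i] by (auto simp: lookup_scale A_def lookup_single when_def)
    next
      case False
      then have "Poly_Mapping.lookup a d = 0"
        using supp a by (cases "d \<in> universe E") (auto simp: in_keys_iff)
      then show ?thesis
        using False nth_I[OF i] by (auto simp: lookup_scale lookup_single when_def)
    qed
    then have "scale (A i) a = scale (A i) (basis_vector (es ! i))"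
      by (rule poly_mapping_eqI)
    moreover have "congruence (vec_signature \<tau> E) (vec_algebra E lst) ?K"
    proof (rule congruence_central_idempotent[OF alg lst])
      show "A i * x = x * A i" for x
        unfolding A_def using comm nth_I[OF i] by blast
      show "A i * A i = A i"
        using A_orth[OF i i] by simp
    qed
    ultimately show "?P \<subseteq> ?K"
      using a basis[OF i] by (intro principal_congruence_least) auto
  next
    have cong: "congruence (vec_signature \<tau> E) (vec_algebra E lst) ?P"
      using a basis[OF i]
      by (intro congruence_principal_congruence is_algebra_vec_algebra alg lst) simp_all
    \<comment> \<open>Applying \<open>q_op\<close> with \<open>u\<close> at index \<open>i\<close>
      and \<open>0\<close> elsewhere links \<open>u\<close> to its multiple by \<open>A i\<close>;
      equal multiples therefore force related vectors.\<close>
    have component: "(scale (A i) u, u) \<in> ?P" if u: "u \<in> vecs E" for u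
    proof -
      have "(\<Sum>j<n. scale (A j) (if j = i then u else 0)) = (\<Sum>j<n. if j = i then scale (A i) u else 0)"
        by (intro sum.cong) auto
      then show ?thesis
        using congruence_q_op[OF lst I cong, of a i "\<lambda>j. if j = i then u else 0"] i u
        by (simp add: n_def es_def A_def principal_congruence_contains)
    qed
    show "?K \<subseteq> ?P"
    proof clarify
      fix u w :: "'e \<Rightarrow>\<^sub>0 'r"
      assume "Poly_Mapping.keys u \<subseteq> universe E" "Poly_Mapping.keys w \<subseteq> universe E"
        and "scale (A i) u = scale (A i) w"
      then have "(scale (A i) u, u) \<in> ?P" "(scale (A i) u, w) \<in> ?P"
        using component[of u] component[of w] by auto
      then show "(u, w) \<in> ?P"
        using congruenceD(1)[OF cong] by (meson equivE symE transE)
    qed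
  qed
  have "\<exists>!u. u \<in> vecs E \<and> (\<forall>i<n. scale (A i) u = scale (A i) (w i))"
    if w: "\<And>i. i < n \<Longrightarrow> w i \<in> vecs E" for w
  \<comment> \<open>Orthogonality shows that this sum is a solution; the coefficients summing to
    \<open>1\<close> will show that it is the only one.\<close>
  proof (rule ex1I[of _ "\<Sum>j<n. scale (A j) (w j)"])
    have "scale (A i) (\<Sum>j<n. scale (A j) (w j)) = scale (A i) (w i)" if i: "i < n" for i
    proof -
      have "scale (A i) (\<Sum>j<n. scale (A j) (w j)) = (\<Sum>j<n. if j = i then scale (A i) (w i) else 0)"
        unfolding scale_sum by (intro sum.cong) (auto simp: scale_scale A_orth i)
      then show ?thesis
        using i by simp
    qed
    moreover have "(\<Sum>j<n. scale (A j) (w j)) \<in> vecs E"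
      by (rule vecs_sum, rule vecs_scale) (use w in auto)
    ultimately show "(\<Sum>j<n. scale (A j) (w j)) \<in> vecs E \<and>
        (\<forall>i<n. scale (A i) (\<Sum>j<n. scale (A j) (w j)) = scale (A i) (w i))"
      by blast
  next
    fix u assume u: "u \<in> vecs E \<and> (\<forall>i<n. scale (A i) u = scale (A i) (w i))"
    have "u = scale (\<Sum>j<n. A j) u"
      by (simp add: sum_A)
    also have "\<dots> = (\<Sum>j<n. scale (A j) (w j))"
      unfolding sum_scale using u by (intro sum.cong) auto
    finally show "u = (\<Sum>j<n. scale (A j) (w j))" .
  qed
  then have ex1: "\<exists>!u. u \<in> vecs E \<and> (\<forall>i<n. (u, w i) \<in> principal_congruence (vec_signature \<tau> E)
      (vec_algebra E lst) a (basis_vector (es ! i)))" if "\<And>i. i < n \<Longrightarrow> w i \<in> vecs E" for w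
    using that by (simp add: \<theta> cong: conj_cong)
  then show ?thesis
    unfolding I_central_iff_ex1[OF alg lst I a] n_def es_def by blast
qed

theorem theorem5p1:
  fixes \<tau> :: "'f signature"
    and E :: "('e, 'f) algebra"
    and lst :: "'e set \<Rightarrow> 'e list"
    and I :: "'e set"
    and a :: "'e \<Rightarrow>\<^sub>0 'r::{semiring_0, monoid_mult}"
  assumes "is_algebra \<tau> E"
    and "is_listing E lst"
    and "finite I" and "I \<noteq> {}" and "I \<subseteq> universe E"
    and "a \<in> universe (vec_algebra E lst)"
  shows "I_central \<tau> E lst I a \<longleftrightarrow>
    (\<forall>d\<in>universe E - I. Poly_Mapping.lookup a d = 0) \<and>
    (\<Sum>e\<in>I. Poly_Mapping.lookup a e) = 1 \<and>
    (\<forall>e\<in>I. \<forall>x. Poly_Mapping.lookup a e * x = x * Poly_Mapping.lookup a e) \<and>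
    (\<forall>e\<in>I. \<forall>e'\<in>I.
      Poly_Mapping.lookup a e * Poly_Mapping.lookup a e' = (if e = e' then Poly_Mapping.lookup a e else 0))"
proof -
  have a: "a \<in> vecs E"
    using assms(6) by simp
  show ?thesis
    using central_imp_coefficients[OF assms(1-5) a] coefficients_imp_central[OF assms(1-5) a]
    by blast
qed

end
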